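(* A cyclic $t$-shape $T$ is amenable if and only if there is an integer $n\ge 0$ such that $D^n(T)$ is either a one-clump shape or the cyclic $t$-shape $tt^{-1}$.
   Context: A $t$-shape of width $w\ge 1$ is a finite formal sequence $t^{\varepsilon_1}t^{\varepsilon_2}\cdots t^{\varepsilon_w}$ with each $\varepsilon_i\in\{1,-1\}$ (no cancellation is performed); a cyclic $t$-shape is a $t$-shape considered up to cyclic permutation. For $m\ge 1$, $t^m$ abbreviates $tt\cdots t$ ($m$ letters) and $t^{-m}$ abbreviates $t^{-1}t^{-1}\cdots t^{-1}$ ($m$ letters). Inversion is the operation of replacing a cyclic $t$-shape by its formal inverse (reverse the order and change the sign of every exponent). Magnus derivative $D$: arrange the signs of the exponents of a cyclic $t$-shape $T$ around a circle. Between each two cyclically consecutive signs $+,+$ insert a new $+$; between each two cyclically consecutive signs $-,-$ insert a new $-$; in all other cases insert nothing. Then delete the original signs. The remaining cyclic sequence of (new) signs defines $D(T)$, which may be empty; $D$ of the empty sequence is empty. (For width $1$, the single letter is cyclically adjacent to itself, so $D(t)=t$.) $D^n$ is the $n$-fold iterate, $D^0(T)=T$. Blocks and blow-ups: for an integer $m\ge 0$, an $m$-block is a finite, possibly empty, non-cyclic sequence $t^{\varepsilon_1}\cdots t^{\varepsilon_k}$, $\varepsilon_i=\pm1$, with total sum $\varepsilon_1+\dots+\varepsilon_k=0$ and all of whose partial sums $\varepsilon_1+\dots+\varepsilon_i$ ($0\le i\le k$) lie in $[-m,0]$. It is full if some partial sum (including the empty one) equals $-m$. An $m$-blow up of a cyclic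 $t$-shape $T$ is any cyclic $t$-shape obtained by inserting, between each pair of cyclically consecutive letters of $T$, an $m$-block, where the block inserted between a pair $t^{-1},t$ (in this order) must be full; the blocks are otherwise arbitrary and chosen independently. Clumps: a clump in a cyclic $t$-shape is a maximal connected (cyclically consecutive) subsequence of the form $t^m$ with $|m|>1$; it is an up clump if $m>0$ and a down clump if $m<0$. A one-clump shape is a cyclic $t$-shape with exactly one clump, which is not the whole sequence; i.e. after possible cyclic permutation and inversion it is $t^mt^{-1}(tt^{-1})^r$ with $m>1$, $r\ge 0$. A cyclic $t$-shape is suitable if it has exactly one up clump, which is not the whole sequence, and possibly some down clumps, or if it has exactly one down clump, which is not the whole sequence, and possibly some up clumps; i.e. after possible cyclic permutation and inversion it is $t^st^{-r_0}tt^{-r_1}t\cdots tt^{-r_k}$ with $s>1$, $k\ge 0$, $r_i\ge 1$. Amenability: a cyclic $t$-shape is amenable if it is an $m$-blow up of a suitable $t$-shape for some integer $m\ge 0$; in addition, by convention, the cyclic $t$-shape $tt^{-1}$ is declared to be amenable. *)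

theory Defs
  imports Main
begin

datatype letter = Pos | Neg  \<comment> \<open>the letters \<open>t\<close> and \<open>t\<^sup>-\<^sup>1\<close>\<close>

fun expo :: "letter \<Rightarrow> int" where
  "expo Pos = 1"
| "expo Neg = -1"

definition cyc_eq :: "letter list \<Rightarrow> letter list \<Rightarrow> bool" where
  "cyc_eq xs ys \<longleftrightarrow> (\<exists>n. ys = rotate n xs)"

lemma equivp_cyc_eq: "equivp cyc_eq"
proof (rule equivpI)
  show "reflp cyc_eq"
    by (rule reflpI) (auto simp: cyc_eq_def intro: exI[of _ 0])
  show "symp cyc_eq"
  proof (rule sympI)
    fix xs ys assume "cyc_eq xs ys"
    then obtain n where n: "ys = rotate (n mod length xs) xs"
      by (auto simp: cyc_eq_def simp flip: rotate_conv_mod)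
    show "cyc_eq ys xs"
    proof (cases "xs = []")
      case True
      then show ?thesis using n by (simp add: cyc_eq_def)
    next
      case False
      then have "n mod length xs \<le> length xs" by (simp add: less_imp_le)
      then have "rotate (length xs - n mod length xs) ys = xs"
        by (simp add: n rotate_rotate)
      then show ?thesis by (metis cyc_eq_def)
    qed
  qed
  show "transp cyc_eq"
    by (rule transpI) (auto simp: cyc_eq_def rotate_rotate)
qed

text \<open>The type contains the class of the empty word, which is a possible value of the Magnus
  derivative.\<close>

quotient_type cshape = "letter list" / cyc_eq
  by (rule equivp_cyc_eq)

abbreviation cyc :: "letter list \<Rightarrow> cshape" where
  "cyc \<equiv> abs_cshape"

lemma cyc_eq_refl: "cyc_eq xs xs"
  by (rule equivp_reflp[OF equivp_cyc_eq])

lemma cyc_eq_invariant: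
  assumes "\<And>xs. f (rotate1 xs) = f xs" and "cyc_eq xs ys"
  shows "f xs = f ys"
proof -
  have "f (rotate n xs) = f xs" for n
    by (induction n) (simp_all add: assms(1))
  then show ?thesis using assms(2) by (auto simp: cyc_eq_def)
qed

lift_definition width :: "cshape \<Rightarrow> nat" is "length :: letter list \<Rightarrow> nat"
  by (rule cyc_eq_invariant) simp_all

text \<open>The new sign inserted between two cyclically consecutive equal signs is their common value.
  For a word of length 1 the only pair is the letter with itself.\<close>

definition magnus_word :: "letter list \<Rightarrow> letter list" where
  "magnus_word xs = map fst (filter (\<lambda>(a, b). a = b) (zip xs (rotate1 xs)))"

lemma cyc_eq_magnus_rotate1: "cyc_eq (magnus_word xs) (magnus_word (rotate1 xs))"
proof (cases xs)
  case Nil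
  then show ?thesis by (simp add: cyc_eq_refl)
next
  case (Cons x xs')
  define ps where "ps = zip xs (rotate1 xs)"
  have "rotate1 ps = zip (rotate1 xs) (rotate1 (rotate1 xs))"
  proof (cases xs')
    case Nil
    then show ?thesis by (simp add: ps_def Cons)
  next
    case (Cons a ys)
    then show ?thesis
      using zip_append[of "a # ys" "ys @ [x]" "[x]" "[a]"] by (simp add: ps_def \<open>xs = x # xs'\<close>)
  qed
  then have r: "magnus_word (rotate1 xs) = map fst (filter (\<lambda>(a, b). a = b) (rotate1 ps))"
    by (simp add: magnus_word_def)
  have l: "magnus_word xs = map fst (filter (\<lambda>(a, b). a = b) ps)"
    by (simp add: magnus_word_def ps_def)
  show ?thesis
  proof (cases ps)
    case Nil
    then show ?thesis using l r by (simp add: cyc_eq_refl)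
  next
    case (Cons p ps')
    show ?thesis
    proof (cases "fst p = snd p")
      case True
      then have "magnus_word (rotate1 xs) = rotate 1 (magnus_word xs)"
        using l r Cons by (auto simp: case_prod_beta)
      then show ?thesis unfolding cyc_eq_def by blast
    next
      case False
      then have "magnus_word (rotate1 xs) = magnus_word xs"
        using l r Cons by (auto simp: case_prod_beta)
      then show ?thesis by (simp add: cyc_eq_refl)
    qed
  qed
qed

lift_definition magnus :: "cshape \<Rightarrow> cshape" is magnus_word
proof -
  fix xs ys assume "cyc_eq xs ys"
  then obtain n where "ys = rotate n xs" by (auto simp: cyc_eq_def)
  moreover have "cyc_eq (magnus_word xs) (magnus_word (rotate n xs))"
  proof (induction n)
    case 0
    then show ?case by (simp add: cyc_eq_refl)
  next
    case (Suc n)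
    then have "cyc_eq (magnus_word xs) (magnus_word (rotate1 (rotate n xs)))"
      by (rule equivp_transp[OF equivp_cyc_eq _ cyc_eq_magnus_rotate1])
    then show ?case by simp
  qed
  ultimately show "cyc_eq (magnus_word xs) (magnus_word ys)" by simp
qed

definition psum :: "letter list \<Rightarrow> nat \<Rightarrow> int" where
  "psum xs i = (\<Sum>j<i. expo (xs ! j))"

definition block :: "nat \<Rightarrow> letter list \<Rightarrow> bool" where
  "block m xs \<longleftrightarrow> psum xs (length xs) = 0 \<and> (\<forall>i\<le>length xs. psum xs i \<in> {- int m..0})"

definition full :: "nat \<Rightarrow> letter list \<Rightarrow> bool" where
  "full m xs \<longleftrightarrow> (\<exists>i\<le>length xs. psum xs i = - int m)"

text \<open>The block \<open>bs ! i\<close> goes between \<open>as ! i\<close> and its cyclic successor.\<close>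

definition blow_up :: "nat \<Rightarrow> cshape \<Rightarrow> cshape \<Rightarrow> bool" where
  "blow_up m S T \<longleftrightarrow>
     (\<exists>as bs. S = cyc as \<and> length bs = length as \<and>
        (\<forall>i<length as. block m (bs ! i) \<and>
           (as ! i = Neg \<and> as ! (Suc i mod length as) = Pos \<longrightarrow> full m (bs ! i))) \<and>
        T = cyc (concat (map2 (#) as bs)))"

text \<open>A cyclically consecutive subsequence of a word of length \<open>w\<close> is represented by its set of
  positions, so that a whole word \<open>t\<^sup>w\<close> counts as one subsequence, irrespective of where one
  starts reading. The bound \<open>l \<le> w\<close> means that no letter is used twice.\<close>

definition arc :: "nat \<Rightarrow> nat \<Rightarrow> nat \<Rightarrow> nat set" where
  "arc w i l = (\<lambda>j. (i + j) mod w) ` {..<l}"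

definition power_arc :: "letter \<Rightarrow> letter list \<Rightarrow> nat set \<Rightarrow> bool" where
  "power_arc a xs C \<longleftrightarrow>
     (\<exists>i l. i < length xs \<and> 1 < l \<and> l \<le> length xs \<and> C = arc (length xs) i l) \<and>
     (\<forall>p\<in>C. xs ! p = a)"

definition clump :: "letter \<Rightarrow> letter list \<Rightarrow> nat set \<Rightarrow> bool" where
  "clump a xs C \<longleftrightarrow> power_arc a xs C \<and> (\<forall>C'. power_arc a xs C' \<and> C \<subseteq> C' \<longrightarrow> C' = C)"

definition one_clump_word :: "letter list \<Rightarrow> bool" where
  "one_clump_word xs \<longleftrightarrow>
     (\<exists>C. {C'. \<exists>a. clump a xs C'} = {C} \<and> C \<noteq> {..<length xs})"

text \<open>The existential quantifier over \<open>a\<close> covers both cases, a unique up clump (\<open>a = Pos\<close>) and a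
  unique down clump (\<open>a = Neg\<close>). Clumps of the other sign are unrestricted.\<close>

definition suitable_word :: "letter list \<Rightarrow> bool" where
  "suitable_word xs \<longleftrightarrow>
     (\<exists>a C. {C'. clump a xs C'} = {C} \<and> C \<noteq> {..<length xs})"

text \<open>The predicates above are invariant under rotation: rotating a word by one letter moves the
  letter at position \<open>shift w p\<close> to position \<open>p\<close>.\<close>

definition shift :: "nat \<Rightarrow> nat \<Rightarrow> nat" where
  "shift w p = (p + 1) mod w"

lemma shift_less: "p < w \<Longrightarrow> shift w p < w"
  unfolding shift_def by (rule mod_less_divisor) simp

lemma inj_on_shift: "inj_on (shift w) {..<w}"
  unfolding inj_on_def shift_def by (auto simp: mod_Suc split: if_splits)

lemma shift_image: "shift w ` {..<w} = {..<w}"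
  by (rule card_subset_eq) (auto simp: card_image[OF inj_on_shift], simp add: shift_def)

lemma arc_subset: "i < w \<Longrightarrow> arc w i l \<subseteq> {..<w}"
  by (auto simp: arc_def)

lemma shift_arc: "shift w ` arc w i l = arc w (shift w i) l"
  unfolding arc_def image_image
  by (rule image_cong) (auto simp: shift_def mod_simps ac_simps)

lemma power_arc_subset: "power_arc a xs C \<Longrightarrow> C \<subseteq> {..<length xs}"
  using arc_subset by (auto simp: power_arc_def)

lemma nth_rotate1_shift: "p < length xs \<Longrightarrow> rotate1 xs ! p = xs ! shift (length xs) p"
  by (simp add: nth_rotate1 shift_def)

lemma power_arc_rotate1:
  assumes "C \<subseteq> {..<length xs}"
  shows "power_arc a (rotate1 xs) C \<longleftrightarrow> power_arc a xs (shift (length xs) ` C)"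
proof -
  let ?w = "length xs"
  have "(\<exists>i l. i < ?w \<and> 1 < l \<and> l \<le> ?w \<and> C = arc ?w i l) \<longleftrightarrow>
        (\<exists>i l. i < ?w \<and> 1 < l \<and> l \<le> ?w \<and> shift ?w ` C = arc ?w i l)" (is "?L \<longleftrightarrow> ?R")
  proof
    assume ?L
    then show ?R
      proof (elim exE conjE)
      fix i l assume *: "i < ?w" "1 < l" "l \<le> ?w" "C = arc ?w i l"
      have "shift ?w i < ?w" using *(1) by (rule shift_less)
      then show ?R using * shift_arc[of ?w i l] by blast
    qed
  next
    assume ?R
    then obtain i l where *: "i < ?w" "1 < l" "l \<le> ?w" "shift ?w ` C = arc ?w i l" by blast
    obtain i' where "i' < ?w" "i = shift ?w i'"
      using *(1) shift_image[of ?w] by auto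
    then have "shift ?w ` C = shift ?w ` arc ?w i' l" using * by (simp add: shift_arc)
    then have "C = arc ?w i' l"
      using inj_on_image_eq_iff[OF inj_on_shift assms arc_subset[OF \<open>i' < ?w\<close>]] by simp
    then show ?L using * \<open>i' < ?w\<close> by blast
  qed
  moreover have "(\<forall>p\<in>C. rotate1 xs ! p = a) \<longleftrightarrow> (\<forall>p\<in>shift ?w ` C. xs ! p = a)"
  proof -
    have "rotate1 xs ! p = xs ! shift ?w p" if "p \<in> C" for p
      using assms that nth_rotate1_shift by blast
    then show ?thesis by simp
  qed
  ultimately show ?thesis by (simp add: power_arc_def)
qed

lemma clump_rotate1:
  assumes "C \<subseteq> {..<length xs}"
  shows "clump a (rotate1 xs) C \<longleftrightarrow> clump a xs (shift (length xs) ` C)"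
proof -
  let ?s = "shift (length xs)"
  have sub: "C' \<subseteq> ?s ` {..<length xs}" if "power_arc a xs C'" for C'
    using power_arc_subset[OF that] by (simp add: shift_image)
  have "(\<forall>C'. power_arc a (rotate1 xs) C' \<and> C \<subseteq> C' \<longrightarrow> C' = C) \<longleftrightarrow>
        (\<forall>C'. power_arc a xs C' \<and> ?s ` C \<subseteq> C' \<longrightarrow> C' = ?s ` C)" (is "?L \<longleftrightarrow> ?R")
  proof
    assume L: ?L
    show ?R
    proof (intro allI impI, elim conjE)
      fix C' assume C': "power_arc a xs C'" "?s ` C \<subseteq> C'"
      obtain B where B: "B \<subseteq> {..<length xs}" "C' = ?s ` B"
        using sub[OF C'(1)] by (auto simp: subset_image_iff)
      have "C \<subseteq> B"
      proof
        fix p assume p: "p \<in> C"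
        then have "?s p \<in> ?s ` B" using C'(2) B(2) by blast
        then show "p \<in> B"
          using inj_on_image_mem_iff[OF inj_on_shift subsetD[OF assms p] B(1)] by (rule iffD1[rotated])
      qed
      moreover have "power_arc a (rotate1 xs) B" using C'(1) power_arc_rotate1[OF B(1)] B(2) by simp
      ultimately have "B = C" using L by simp
      then show "C' = ?s ` C" using B(2) by simp
    qed
  next
    assume R: ?R
    show ?L
    proof (intro allI impI, elim conjE)
      fix B assume B: "power_arc a (rotate1 xs) B" "C \<subseteq> B"
      have Bs: "B \<subseteq> {..<length xs}" using power_arc_subset[OF B(1)] by simp
      have "power_arc a xs (?s ` B)" using B(1) power_arc_rotate1[OF Bs] by simp
      then have "?s ` B = ?s ` C" using R image_mono[OF B(2), of ?s] by simp
      then show "B = C" using inj_on_image_eq_iff[OF inj_on_shift Bs assms] by simp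
    qed
  qed
  then show ?thesis by (simp add: clump_def power_arc_rotate1[OF assms])
qed

lemma clump_subset: "clump a xs C \<Longrightarrow> C \<subseteq> {..<length xs}"
  unfolding clump_def by (elim conjE) (rule power_arc_subset)

lemma unique_clump_rotate1:
  "(\<exists>C. {C'. \<exists>a\<in>A. clump a (rotate1 xs) C'} = {C} \<and> C \<noteq> {..<length (rotate1 xs)}) \<longleftrightarrow>
   (\<exists>C. {C'. \<exists>a\<in>A. clump a xs C'} = {C} \<and> C \<noteq> {..<length xs})"
proof -
  let ?s = "shift (length xs)" and ?W = "{..<length xs}"
  let ?X = "{C. \<exists>a\<in>A. clump a xs C}" and ?Y = "{C. \<exists>a\<in>A. clump a (rotate1 xs) C}"
  have X: "?X \<subseteq> Pow ?W" by (auto dest: clump_subset)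
  have Y: "?Y \<subseteq> Pow ?W"
  proof
    fix C assume "C \<in> ?Y"
    then have "C \<subseteq> {..<length (rotate1 xs)}" using clump_subset by blast
    then show "C \<in> Pow ?W" by simp
  qed
  have im: "?X = image ?s ` ?Y"
  proof (intro equalityI subsetI)
    fix C assume C: "C \<in> ?X"
    then have "C \<in> Pow ?W" using X by (rule subsetD[rotated])
    then have "C \<subseteq> ?s ` ?W" by (simp add: shift_image)
    then obtain B where B: "B \<subseteq> ?W" "C = ?s ` B" by (auto simp: subset_image_iff)
    have "B \<in> ?Y" using C B(2) clump_rotate1[OF B(1)] by simp
    then show "C \<in> image ?s ` ?Y" unfolding B(2) by (rule imageI)
  next
    fix C assume "C \<in> image ?s ` ?Y"
    then obtain B where B: "B \<in> ?Y" "C = ?s ` B" by (elim imageE)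
    then have "B \<subseteq> ?W" using subsetD[OF Y B(1)] by simp
    then show "C \<in> ?X" using B clump_rotate1 by simp
  qed
  have inj: "inj_on (image ?s) (Pow ?W)"
    by (rule inj_on_image_Pow[OF inj_on_shift])
  have W: "?s ` C = ?W \<longleftrightarrow> C = ?W" if "C \<subseteq> ?W" for C
    using inj_on_image_eq_iff[OF inj_on_shift that order_refl] by (simp add: shift_image)
  have sing: "?X = {?s ` C} \<longleftrightarrow> ?Y = {C}" if "C \<subseteq> ?W" for C
  proof -
    have "?X = {?s ` C} \<longleftrightarrow> image ?s ` ?Y = image ?s ` {C}" by (simp only: im image_insert image_empty)
    also have "\<dots> \<longleftrightarrow> ?Y = {C}"
      by (rule inj_on_image_eq_iff[OF inj Y]) (simp add: that)
    finally show ?thesis .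
  qed
  show ?thesis
  proof
    assume "\<exists>C. ?Y = {C} \<and> C \<noteq> {..<length (rotate1 xs)}"
    then obtain C where C: "?Y = {C}" "C \<noteq> ?W" by auto
    then have sub: "C \<subseteq> ?W" using Y by blast
    have "?X = {?s ` C}" using sing[OF sub] C(1) by (rule iffD2)
    moreover have "?s ` C \<noteq> ?W" using W[OF sub] C(2) by simp
    ultimately show "\<exists>C. ?X = {C} \<and> C \<noteq> ?W" by (intro exI conjI)
  next
    assume "\<exists>C. ?X = {C} \<and> C \<noteq> ?W"
    then obtain C where C: "?X = {C}" "C \<noteq> ?W" by (elim exE conjE)
    then have "C \<in> Pow ?W" using X by blast
    then have "C \<subseteq> ?s ` ?W" by (simp add: shift_image)
    then obtain B where B: "B \<subseteq> ?W" "C = ?s ` B" by (auto simp: subset_image_iff)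
    have "?Y = {B}" using sing[OF B(1)] C(1) unfolding B(2) by (rule iffD1)
    moreover have "B \<noteq> {..<length (rotate1 xs)}" using W[OF B(1)] C(2) B(2) by simp
    ultimately show "\<exists>C. ?Y = {C} \<and> C \<noteq> {..<length (rotate1 xs)}" by (intro exI conjI)
  qed
qed

lemma one_clump_word_rotate1: "one_clump_word (rotate1 xs) = one_clump_word xs"
  using unique_clump_rotate1[of UNIV xs] by (simp add: one_clump_word_def)

lemma suitable_word_rotate1: "suitable_word (rotate1 xs) = suitable_word xs"
proof -
  have "(\<exists>C. {C'. clump a (rotate1 xs) C'} = {C} \<and> C \<noteq> {..<length (rotate1 xs)}) \<longleftrightarrow>
        (\<exists>C. {C'. clump a xs C'} = {C} \<and> C \<noteq> {..<length xs})" for a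
    using unique_clump_rotate1[of "{a}" xs] by simp
  then show ?thesis by (simp only: suitable_word_def)
qed

lift_definition one_clump :: "cshape \<Rightarrow> bool" is one_clump_word
  by (rule cyc_eq_invariant[where f = one_clump_word, OF one_clump_word_rotate1])

lift_definition suitable :: "cshape \<Rightarrow> bool" is suitable_word
  by (rule cyc_eq_invariant[where f = suitable_word, OF suitable_word_rotate1])

definition amenable :: "cshape \<Rightarrow> bool" where
  "amenable T \<longleftrightarrow> (\<exists>m S. suitable S \<and> blow_up m S T) \<or> T = cyc [Pos, Neg]"

end

theory Submission
  imports Defs
begin

text \<open>Up to a shift of the letters, the derivative deletes every factor \<open>Neg, Pos\<close> of a cyclic word.
  Hence \<open>D(T) = S\<close> for nonempty \<open>S\<close> iff \<open>T\<close> is a \<open>1\<close>-blow up of \<open>S\<close>, and inductively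
  \<open>D\<^sup>m(T) = S\<close> iff \<open>T\<close> is an \<open>m\<close>-blow up of \<open>S\<close>: deletion removes the deepest level of
  the blocks. So \<open>T\<close> is amenable iff some derivative is suitable or \<open>T = tt\<^sup>-\<^sup>1\<close>. The derivative
  of a suitable shape that is not one-clump is \<open>a\<^sup>p b\<^sup>q\<close> with \<open>a \<noteq> b\<close>, whose derivatives
  \<open>a\<^sup>p\<^sup>-\<^sup>i b\<^sup>q\<^sup>-\<^sup>i\<close> end in a one-clump shape or in \<open>tt\<^sup>-\<^sup>1\<close>. Conversely one-clump shapes are suitable,
  and so is every shape with derivative \<open>tt\<^sup>-\<^sup>1\<close>.\<close>

section \<open>Representatives of cyclic words\<close>

lemma cyc_append_commute: "cyc (xs @ ys) = cyc (ys @ xs)"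
  by (metis cshape.abs_eq_iff cyc_eq_def rotate_append)

lemma cyc_eq_split:
  assumes "cyc xs = cyc ys" "xs \<noteq> []"
  obtains u v where "xs = u @ v" "ys = v @ u" "v \<noteq> []"
proof -
  obtain n where n: "ys = rotate n xs"
    using assms(1) by (auto simp: cshape.abs_eq_iff cyc_eq_def)
  show thesis
  proof (rule that)
    show "xs = take (n mod length xs) xs @ drop (n mod length xs) xs" by simp
    show "ys = drop (n mod length xs) xs @ take (n mod length xs) xs"
      unfolding n by (rule rotate_drop_take)
    have "n mod length xs < length xs" using assms(2) by (intro mod_less_divisor) simp
    then show "drop (n mod length xs) xs \<noteq> []" by simp
  qed
qed

lemma cyc_eq_Nil_iff: "cyc xs = cyc [] \<longleftrightarrow> xs = []"
  by (auto simp: cshape.abs_eq_iff cyc_eq_def) (metis rotate_is_Nil_conv)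

lemma cshape_cases: obtains xs where "T = cyc xs"
  by (metis Quotient_abs_rep Quotient_cshape)

lemma letter_other: "a \<noteq> (b :: letter) \<Longrightarrow> x \<noteq> a \<longleftrightarrow> x = b"
  by (cases a; cases b; cases x) auto


section \<open>The derivative as deletion of factors\<close>

text \<open>\<open>e\<close> is the letter that follows the end of the word. In a cyclic word this
  is the first letter; keeping it separate allows recursion on suffixes.\<close>

fun magnus_lin :: "letter list \<Rightarrow> letter \<Rightarrow> letter list" where
  "magnus_lin [] e = []"
| "magnus_lin [x] e = (if x = e then [x] else [])"
| "magnus_lin (x # y # xs) e = (if x = y then [x] else []) @ magnus_lin (y # xs) e"

lemma magnus_word_lin: "magnus_word (x # xs) = magnus_lin (x # xs) x"
proof -
  have "map fst (filter (\<lambda>(a, b). a = b) (zip (x # xs) (xs @ [e]))) = magnus_lin (x # xs) e" for e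
    by (induction xs arbitrary: x) auto
  then show ?thesis by (simp add: magnus_word_def)
qed

text \<open>A letter of the derivative comes from a pair of equal neighbours. Identify a pair
  \<open>Pos, Pos\<close> with its second letter and a pair \<open>Neg, Neg\<close> with its first one: the letters of
  the word that are not hit are exactly those in the factors \<open>Neg, Pos\<close>.\<close>

fun der :: "letter list \<Rightarrow> letter list" where
  "der [] = []"
| "der (Pos # xs) = Pos # der xs"
| "der [Neg] = [Neg]"
| "der (Neg # Neg # xs) = Neg # der (Neg # xs)"
| "der (Neg # Pos # xs) = der xs"

lemma der_Neg: "xs = [] \<or> hd xs = Neg \<Longrightarrow> der (Neg # xs) = Neg # der xs"
  by (cases xs) auto

lemma der_Cons_iff: "der (x # xs) = x # der xs \<longleftrightarrow> x = Pos \<or> xs = [] \<or> hd xs = Neg"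
proof (cases "x = Neg \<and> xs \<noteq> [] \<and> hd xs = Pos")
  case True
  then obtain ys where "x = Neg" "xs = Pos # ys" by (cases xs) auto
  then show ?thesis by auto
next
  case False
  then have "x = Pos \<or> xs = [] \<or> hd xs = Neg" using letter.exhaust by metis
  then show ?thesis using der_Neg by (cases x) auto
qed

text \<open>Deletion looks only at adjacent letters, so the single obstacle is a factor
  \<open>Neg, Pos\<close> straddling the cut.\<close>

lemma der_append:
  "xs = [] \<or> ys = [] \<or> last xs = Pos \<or> hd ys = Neg \<Longrightarrow> der (xs @ ys) = der xs @ der ys"
proof (induction xs rule: der.induct)
  case (2 xs)
  then show ?case by (cases "xs = []") auto
next
  case 3
  then show ?case by (cases ys) auto
next
  case (5 xs)
  then show ?case by (cases "xs = []") auto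
qed auto

text \<open>On the right a pair \<open>Pos, Pos\<close> is recorded at its second letter. A leading
  \<open>Pos\<close> ends no pair, and the pair closed by \<open>e = Pos\<close> is recorded beyond
  the end: these are the two correction terms. A final \<open>Neg\<close> before
  \<open>e = Pos\<close> would form a factor that \<open>der\<close> cannot see.\<close>

lemma magnus_lin_der:
  assumes "e = Neg \<or> last (x # xs) = Pos"
  shows "(if x = Pos then [Pos] else []) @ magnus_lin (x # xs) e =
         der (x # xs) @ (if e = Pos then [Pos] else [])"
  using assms
proof (induction xs arbitrary: x)
  case Nil
  then show ?case by (cases x; cases e) auto
next
  case (Cons y xs)
  then have IH: "(if y = Pos then [Pos] else []) @ magnus_lin (y # xs) e =
         der (y # xs) @ (if e = Pos then [Pos] else [])" by auto
  then show ?case by (cases x; cases y) auto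
qed

text \<open>Reading must not start inside a factor \<open>Neg Pos\<close> of the cyclic word.\<close>

lemma magnus_cyc_der:
  assumes "xs \<noteq> [] \<Longrightarrow> hd xs = Neg \<or> last xs = Pos"
  shows "magnus (cyc xs) = cyc (der xs)"
proof (cases xs)
  case Nil
  then show ?thesis by (simp add: magnus.abs_eq magnus_word_def)
next
  case (Cons x ys)
  show ?thesis
  proof (cases x)
    case Neg
    then show ?thesis
      using magnus_lin_der[of Neg Neg ys] by (simp add: Cons magnus.abs_eq magnus_word_lin)
  next
    case Pos
    then have "last (x # ys) = Pos" using assms Cons by simp
    \<comment> \<open>The correction terms cancel only up to rotation: \<open>Pos\<close> moves from
      the front to the end.\<close>
    then have "magnus_lin (Pos # ys) Pos = der ys @ [Pos]"
      using magnus_lin_der[of Pos x ys] Pos by simp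
    then have "magnus (cyc xs) = cyc (der ys @ [Pos])"
      by (simp add: Cons Pos magnus.abs_eq magnus_word_lin)
    then show ?thesis using cyc_append_commute[of "der ys" "[Pos]"] Cons Pos by simp
  qed
qed

text \<open>Start reading at a \<open>Neg\<close> if there is one; otherwise all letters are
  \<open>Pos\<close>.\<close>

lemma cyc_good_word:
  obtains xs where "T = cyc xs" "xs \<noteq> [] \<Longrightarrow> hd xs = Neg \<or> last xs = Pos"
proof -
  obtain ys where ys: "T = cyc ys" by (rule cshape_cases)
  show thesis
  proof (cases "Neg \<in> set ys")
    case True
    then obtain u v where "ys = u @ Neg # v" by (auto dest: split_list)
    then have "T = cyc (Neg # v @ u)" using ys cyc_append_commute[of u "Neg # v"] by simp
    then show thesis using that by simp
  next
    case False
    then have "ys \<noteq> [] \<Longrightarrow> last ys = Pos" using last_in_set letter.exhaust by metis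
    then show thesis using that ys by blast
  qed
qed

text \<open>Every letter of \<open>der xs\<close> is a letter of \<open>xs\<close> outside the
  factors \<open>Neg, Pos\<close>, so a cut of \<open>der xs\<close> lifts to a cut of
  \<open>xs\<close>. The last two clauses record that \<open>a\<close> belongs to no such
  factor.\<close>

lemma der_split:
  assumes "der xs = u @ a # v"
  shows "\<exists>p q. xs = p @ a # q \<and> der p = u \<and> der q = v \<and> der (a # q) = a # der q \<and>
    (a = Pos \<longrightarrow> p = [] \<or> last p = Pos)"
  using assms
proof (induction "length xs" arbitrary: xs u rule: less_induct)
  case less
  consider ys where "xs = Neg # Pos # ys" | x ys where "xs = x # ys" "der (x # ys) = x # der ys"
  proof (cases xs)
    case (Cons x ys)
    then show thesis using that by (cases x; cases ys; cases "hd ys") auto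
  qed (use less.prems in simp)
  then show ?case
  proof cases
    case (1 ys)
    then obtain p q where pq: "ys = p @ a # q \<and> der p = u \<and> der q = v \<and> der (a # q) = a # der q \<and>
      (a = Pos \<longrightarrow> p = [] \<or> last p = Pos)"
      using less.hyps[of ys u] less.prems by auto
    then show ?thesis by (intro exI[of _ "Neg # Pos # p"] exI[of _ q]) (auto simp: 1)
  next
    case (2 x ys)
    show ?thesis
    proof (cases u)
      case Nil
      then show ?thesis using less.prems 2 by (intro exI[of _ "[]"] exI[of _ ys]) auto
    next
      case (Cons y u')
      then have "der ys = u' @ a # v" "y = x" using less.prems 2 by auto
      then obtain p q where pq: "ys = p @ a # q" "der p = u'" "der q = v" "der (a # q) = a # der q"
        "a = Pos \<longrightarrow> p = [] \<or> last p = Pos"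
        using less.hyps[of ys u'] 2 by auto
      have "x = Pos \<or> hd (p @ a # q) = Neg" using 2 pq(1) der_Cons_iff[of x ys] by auto
      then have "der (x # p) = x # der p" "a = Pos \<longrightarrow> last (x # p) = Pos"
        unfolding der_Cons_iff using pq(5) by (cases p; auto)+
      then show ?thesis using pq 2 Cons \<open>y = x\<close>
        by (intro exI[of _ "x # p"] exI[of _ q]) auto
    qed
  qed
qed

text \<open>Rotating \<open>T\<close> to start at the letter that survives as \<open>a\<close> turns
  an equality of cyclic words into one of words, as needed for recursion along the blocks.\<close>

lemma magnus_eq_Cons:
  assumes "magnus T = cyc (a # v)"
  obtains ws where "T = cyc (a # ws)" "der (a # ws) = a # der ws" "der ws = v"
    "a = Pos \<Longrightarrow> last (a # ws) = Pos"
proof -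
  obtain xs where xs: "T = cyc xs" "xs \<noteq> [] \<Longrightarrow> hd xs = Neg \<or> last xs = Pos"
    using cyc_good_word[of T] by blast
  have "cyc (der xs) = cyc (a # v)" using magnus_cyc_der xs assms by simp
  then obtain u w where uw: "der xs = u @ w" "a # v = w @ u" "w \<noteq> []"
    by (metis cyc_eq_split cyc_eq_Nil_iff list.distinct(1))
  then obtain w' where w: "w = a # w'" "v = w' @ u" by (cases w) auto
  obtain p q where pq: "xs = p @ a # q" "der p = u" "der q = w'" "der (a # q) = a # der q"
    "a = Pos \<longrightarrow> p = [] \<or> last p = Pos"
    using der_split uw(1) w(1) by blast
  have good: "hd xs = Neg \<or> last xs = Pos" using xs(2) pq(1) by simp
  show thesis
  proof
    show "T = cyc (a # q @ p)" using cyc_append_commute[of p "a # q"] xs(1) pq(1) by simp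
    \<comment> \<open>The seam of the rotated word is where \<open>xs\<close> closes up, and
      \<open>xs\<close> was chosen with no factor \<open>Neg, Pos\<close> there.\<close>
    have "q = [] \<or> p = [] \<or> last q = Pos \<or> hd p = Neg" using good pq(1) by auto
    then show "der (q @ p) = v" using pq w by (simp add: der_append)
    show "der (a # q @ p) = a # der (q @ p)"
      using pq(1,4) good unfolding der_Cons_iff by (cases a; cases "p = []") (auto split: if_splits)
    show "last (a # q @ p) = Pos" if "a = Pos"
      using that good pq by (cases "p = []") (auto split: if_splits)
  qed
qed


section \<open>Blow-ups\<close>

text \<open>\<open>h\<close> is the partial sum reached so far; allowing any starting height makes
  induction along \<open>der\<close> possible.\<close>

fun block_from :: "nat \<Rightarrow> int \<Rightarrow> letter list \<Rightarrow> bool" where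
  "block_from m h [] \<longleftrightarrow> h = 0"
| "block_from m h (x # xs) \<longleftrightarrow> h \<in> {- int m..0} \<and> block_from m (h + expo x) xs"

fun full_from :: "nat \<Rightarrow> int \<Rightarrow> letter list \<Rightarrow> bool" where
  "full_from m h [] \<longleftrightarrow> h = - int m"
| "full_from m h (x # xs) \<longleftrightarrow> h = - int m \<or> full_from m (h + expo x) xs"

lemma psum_0 [simp]: "psum xs 0 = 0"
  by (simp add: psum_def)

lemma psum_Cons_Suc [simp]: "psum (x # xs) (Suc i) = expo x + psum xs i"
  unfolding psum_def by (simp only: sum.lessThan_Suc_shift) simp

lemma block_iff: "block m xs \<longleftrightarrow> block_from m 0 xs"
proof -
  have "block_from m h xs \<longleftrightarrow>
     h + psum xs (length xs) = 0 \<and> (\<forall>i\<le>length xs. h + psum xs i \<in> {- int m..0})" for h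
  proof (induction xs arbitrary: h)
    case (Cons x xs)
    have "(\<forall>i\<le>Suc n. P i) \<longleftrightarrow> P 0 \<and> (\<forall>i\<le>n. P (Suc i))" for P :: "nat \<Rightarrow> bool" and n
      using All_less_Suc2[of "Suc n" P] by (simp add: less_Suc_eq_le)
    then show ?case using Cons by (auto simp: add.assoc)
  qed auto
  then show ?thesis by (simp add: block_def)
qed

lemma full_iff: "full m xs \<longleftrightarrow> full_from m 0 xs"
proof -
  have "full_from m h xs \<longleftrightarrow> (\<exists>i\<le>length xs. h + psum xs i = - int m)" for h
  proof (induction xs arbitrary: h)
    case (Cons x xs)
    have "(\<exists>i\<le>Suc n. P i) \<longleftrightarrow> P 0 \<or> (\<exists>i\<le>n. P (Suc i))" for P :: "nat \<Rightarrow> bool" and n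
      using Ex_less_Suc2[of "Suc n" P] by (simp add: less_Suc_eq_le)
    then show ?case using Cons by (auto simp: add.assoc)
  qed auto
  then show ?thesis by (simp add: full_def)
qed

lemma block_0: "block 0 xs \<longleftrightarrow> xs = []"
proof (cases xs)
  case (Cons x ys)
  then show ?thesis by (cases x; cases ys) (auto simp: block_iff)
qed (auto simp: block_iff)

lemma block_hd:
  assumes "block m xs" "xs \<noteq> []"
  shows "hd xs = Neg"
proof (cases xs)
  case (Cons x ys)
  then show ?thesis using assms by (cases x; cases ys) (auto simp: block_iff)
qed (use assms in auto)

lemma block_last:
  assumes "block m xs" "xs \<noteq> []"
  shows "last xs = Pos"
proof -
  have "block_from m h xs \<Longrightarrow> xs \<noteq> [] \<Longrightarrow> last xs = Pos" for h
  proof (induction xs arbitrary: h)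
    case (Cons x xs)
    then show ?case by (cases "xs = []"; cases x) auto
  qed auto
  then show ?thesis using assms block_iff by blast
qed

lemma block_from_range: "block_from m h xs \<Longrightarrow> h \<in> {- int m..0}"
  by (cases xs) auto

text \<open>A step down from height \<open>- int m\<close> must be undone at once, since the block
  may go only one lower. So the lowest level is visited only inside deleted factors.\<close>

lemma block_der:
  assumes "block (Suc m) xs"
  shows "block m (der xs)"
proof -
  have "block_from (Suc m) h xs \<Longrightarrow> - int m \<le> h \<Longrightarrow> block_from m h (der xs)" for h
  proof (induction xs arbitrary: h rule: der.induct)
    case (4 xs)
    \<comment> \<open>Two steps down stay within the bound, so \<open>h - 1\<close> is still at
      least \<open>- int m\<close>.\<close>
    then have "block_from (Suc m) (h - 2) xs" by simp
    from block_from_range[OF this] show ?case using 4 by auto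
  qed auto
  then show ?thesis using assms by (simp add: block_iff)
qed

text \<open>The first visit to \<open>- int (Suc m)\<close> comes from \<open>- int m\<close>; the
  \<open>Neg\<close> leading to that height, if any, is followed by another \<open>Neg\<close> and
  survives.\<close>

lemma full_der:
  assumes "full (Suc m) xs"
  shows "full m (der xs)"
proof -
  have low: "full_from m (- int m) ys" for ys by (cases ys) auto
  have "full_from (Suc m) h xs \<Longrightarrow> - int m \<le> h \<Longrightarrow> full_from m h (der xs)" for h
  proof (induction xs arbitrary: h rule: der.induct)
    case (4 xs)
    then show ?case using low by (cases "h = - int m") auto
  next
    case (5 xs)
    then show ?case using low by (cases "h = - int m") auto
  qed auto
  then show ?thesis using assms by (simp add: full_iff)
qed

text \<open>Reinserting factors \<open>Neg, Pos\<close> only adds dips of depth one.\<close>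

lemma block_of_der:
  assumes "block m (der xs)"
  shows "block (Suc m) xs"
proof -
  have "block_from m h (der xs) \<Longrightarrow> h \<in> {- int m..0} \<Longrightarrow> block_from (Suc m) h xs" for h
  proof (induction xs arbitrary: h rule: der.induct)
    case (2 xs)
    then show ?case using block_from_range[of m "h + 1" "der xs"] by auto
  next
    case (4 xs)
    then show ?case using block_from_range[of m "h - 1" "der (Neg # xs)"] 4(1)[of "h - 1"] by auto
  qed auto
  then show ?thesis using assms by (simp add: block_iff)
qed

text \<open>A surviving \<open>Neg\<close> is never followed by \<open>Pos\<close>, so on reaching
  \<open>- int m\<close> the word \<open>xs\<close> goes one step further down. If it starts at that
  height, \<open>hd xs = Neg\<close> provides the step.\<close>

lemma full_of_der:
  assumes "block m (der xs)" "full m (der xs)" "xs \<noteq> []" "hd xs = Neg"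
  shows "full (Suc m) xs"
proof -
  have "block_from m h (der xs) \<Longrightarrow> full_from m h (der xs) \<Longrightarrow> h \<in> {- int m..0} \<Longrightarrow>
    - int m < h \<or> xs \<noteq> [] \<and> hd xs = Neg \<Longrightarrow> full_from (Suc m) h xs" for h
  proof (induction xs arbitrary: h rule: der.induct)
    case (2 xs)
    then show ?case using block_from_range[of m "h + 1" "der xs"] by auto
  next
    case (4 xs)
    then show ?case using block_from_range[of m "h - 1" "der (Neg # xs)"] 4(1)[of "h - 1"] by auto
  next
    case (5 xs)
    then show ?case by (cases "h = - int m"; cases xs) auto
  qed auto
  then show ?thesis using assms by (simp add: block_iff full_iff)
qed

text \<open>The conditions of \<open>blow_up\<close> in recursive form; \<open>e\<close> follows the
  end of \<open>as\<close>, as in \<open>magnus_lin\<close>.\<close>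

fun valid_blocks :: "nat \<Rightarrow> letter list \<Rightarrow> letter list list \<Rightarrow> letter \<Rightarrow> bool" where
  "valid_blocks m (a # as) (b # bs) e \<longleftrightarrow>
     block m b \<and> (a = Neg \<and> hd (as @ [e]) = Pos \<longrightarrow> full m b) \<and> valid_blocks m as bs e"
| "valid_blocks m [] [] e \<longleftrightarrow> True"
| "valid_blocks m _ _ e \<longleftrightarrow> False"

lemma valid_blocks_iff:
  "valid_blocks m as bs e \<longleftrightarrow> length bs = length as \<and>
     (\<forall>i<length as. block m (bs ! i) \<and>
        (as ! i = Neg \<and> (as @ [e]) ! Suc i = Pos \<longrightarrow> full m (bs ! i)))"
proof (induction m as bs e rule: valid_blocks.induct)
  case (1 m a as b bs e)
  have "(\<forall>i<Suc n. P i) \<longleftrightarrow> P 0 \<and> (\<forall>i<n. P (Suc i))" for P :: "nat \<Rightarrow> bool" and n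
    using less_Suc_eq_0_disj by auto
  then show ?case using 1 by (auto simp: hd_conv_nth)
qed auto

lemma blow_up_iff:
  "blow_up m S T \<longleftrightarrow> (\<exists>as bs. S = cyc as \<and> T = cyc (concat (map2 (#) as bs)) \<and>
     valid_blocks m as bs (hd as))"
proof -
  have "(as @ [hd as]) ! Suc i = as ! (Suc i mod length as)" if "i < length as" for as :: "letter list" and i
    using that by (cases "Suc i = length as") (cases as; auto simp: nth_append)+
  then show ?thesis unfolding blow_up_def valid_blocks_iff by (metis (no_types, lifting))
qed

lemma blow_up_0: "blow_up 0 S T \<longleftrightarrow> S = T"
proof -
  have 1: "concat (map2 (#) as bs) = as" if "valid_blocks 0 as bs e" for as bs e
    using that by (induction "0 :: nat" as bs e rule: valid_blocks.induct) (auto simp: block_0)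
  have 2: "valid_blocks 0 as (map (\<lambda>_. []) as) e" for as e
    by (induction as) (auto simp: block_0 full_iff block_iff)
  show ?thesis unfolding blow_up_iff
    by (metis 1 2 cshape_cases)
qed

text \<open>After a final \<open>Neg\<close> the block is full, hence nonempty, and nonempty blocks
  end in \<open>Pos\<close>. This permits reading the cyclic word from a first letter
  \<open>Pos\<close>.\<close>

lemma last_map2_valid:
  assumes "valid_blocks (Suc m) as bs e" "as \<noteq> []" "e = Pos"
  shows "last (concat (map2 (#) as bs)) = Pos"
  using assms
proof (induction "Suc m" as bs e rule: valid_blocks.induct)
  case (1 a as b bs e)
  show ?case
  proof (cases as)
    case Nil
    then have "bs = []" using 1 by (cases bs) auto
    then show ?thesis using 1 Nil block_last[of "Suc m" b]
      by (cases a; cases b) (auto simp: full_iff)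
  next
    case (Cons a' as')
    then obtain b' bs' where "bs = b' # bs'" using 1 by (cases bs) auto
    then show ?thesis using 1 Cons by auto
  qed
qed auto

text \<open>Nonempty blocks begin with \<open>Neg\<close> and end with \<open>Pos\<close>, and
  fullness forbids an empty one between \<open>Neg\<close> and \<open>Pos\<close>. Hence no deleted
  factor meets a letter of \<open>as\<close>, and \<open>der\<close> acts on each block
  separately.\<close>

lemma der_map2_valid:
  assumes "valid_blocks (Suc m) as bs e"
  shows "der (concat (map2 (#) as bs)) = concat (map2 (#) as (map der bs)) \<and>
    valid_blocks m as (map der bs) e"
  using assms
proof (induction "Suc m" as bs e rule: valid_blocks.induct)
  case (1 a as b bs e)
  let ?r = "concat (map2 (#) as bs)"
  have r: "?r = [] \<or> hd ?r = hd (as @ [e])"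
    using 1 by (cases as; cases bs) auto
  have b: "b = [] \<or> hd b = Neg \<and> last b = Pos" using 1 block_hd block_last by auto
  have "\<not> full (Suc m) []" by (simp add: full_iff)
  moreover have "a = Neg \<and> hd (as @ [e]) = Pos \<longrightarrow> full (Suc m) b" using 1 by simp
  ultimately have "a = Pos \<or> b \<noteq> [] \<or> hd (as @ [e]) = Neg"
    by (cases a; cases "hd (as @ [e])") auto
  then have "der ((a # b) @ ?r) = der (a # b) @ der ?r" using r b by (intro der_append) auto
  moreover have "der (a # b) = a # der b" using b der_Cons_iff by blast
  ultimately show ?case using 1 block_der full_der by auto
qed auto

lemma blow_up_magnus:
  assumes "blow_up (Suc m) S T"
  shows "blow_up m S (magnus T)"
proof -
  obtain as bs where ab: "S = cyc as" "T = cyc (concat (map2 (#) as bs))"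
    "valid_blocks (Suc m) as bs (hd as)"
    using assms blow_up_iff by blast
  let ?x = "concat (map2 (#) as bs)"
  have "hd ?x = Neg \<or> last ?x = Pos" if ne: "?x \<noteq> []"
  proof -
    obtain a as' b bs' where *: "as = a # as'" "bs = b # bs'"
      using ne by (cases as; cases bs) auto
    then show ?thesis using last_map2_valid[OF ab(3)] by (cases a) auto
  qed
  then have "magnus T = cyc (concat (map2 (#) as (map der bs)))"
    using magnus_cyc_der ab der_map2_valid by metis
  then show ?thesis using ab der_map2_valid blow_up_iff by metis
qed

text \<open>The letters of \<open>as\<close> are located one by one among the surviving letters of
  \<open>ws\<close>; the stretches between them become the blocks \<open>cs\<close>.\<close>

lemma valid_blocks_of_der:
  assumes "valid_blocks m (a # as) (b # bs) e" "der (a # ws) = a # der ws"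
    "der ws = b @ concat (map2 (#) as bs)" "e = Pos \<Longrightarrow> last (a # ws) = Pos"
  shows "\<exists>cs. valid_blocks (Suc m) (a # as) cs e \<and> a # ws = concat (map2 (#) (a # as) cs)"
  using assms
proof (induction as arbitrary: a b bs ws)
  case Nil
  then have [simp]: "bs = []" by (cases bs) auto
  have "block (Suc m) ws" using Nil block_of_der by auto
  \<comment> \<open>Here \<open>ws\<close> is nonempty because the word ends in \<open>Pos\<close>,
    and begins with \<open>Neg\<close> because \<open>a\<close> survives.\<close>
  moreover have "full (Suc m) ws" if "a = Neg" "e = Pos"
    using Nil that by (intro full_of_der) (auto simp: der_Cons_iff split: if_splits)
  ultimately show ?case by (intro exI[of _ "[ws]"]) auto
next
  case (Cons a' as)
  then obtain b' bs' where bs: "bs = b' # bs'" by (cases bs) auto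
  have "der ws = b @ a' # (b' @ concat (map2 (#) as bs'))" using Cons bs by simp
  from der_split[OF this] obtain c q where c: "ws = c @ a' # q" "der c = b"
    "der q = b' @ concat (map2 (#) as bs')" "der (a' # q) = a' # der q" by blast
  have "\<exists>cs. valid_blocks (Suc m) (a' # as) cs e \<and> a' # q = concat (map2 (#) (a' # as) cs)"
    using Cons.prems bs c by (intro Cons.IH[of a' b' bs' q]) auto
  then obtain cs where cs: "valid_blocks (Suc m) (a' # as) cs e"
    "a' # q = concat (map2 (#) (a' # as) cs)" by blast
  have "block (Suc m) c" using Cons.prems c block_of_der by auto
  \<comment> \<open>An empty \<open>c\<close> would leave \<open>Neg\<close> directly before
    \<open>Pos\<close>, and \<open>a\<close> would not survive.\<close>
  moreover have "full (Suc m) c" if "a = Neg" "a' = Pos"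
    using Cons.prems c that by (intro full_of_der) (cases c; auto simp: der_Cons_iff)+
  ultimately show ?case using cs c by (intro exI[of _ "c # cs"]) auto
qed

lemma blow_up_of_magnus:
  assumes "blow_up m S (magnus T)" "S \<noteq> cyc []"
  shows "blow_up (Suc m) S T"
proof -
  obtain as bs where ab: "S = cyc as" "magnus T = cyc (concat (map2 (#) as bs))"
    "valid_blocks m as bs (hd as)"
    using assms(1) blow_up_iff by blast
  obtain a as' where as: "as = a # as'" using assms(2) ab(1) by (cases as) auto
  obtain b bs' where bs: "bs = b # bs'" using ab(3) as by (cases bs) auto
  have "magnus T = cyc (a # b @ concat (map2 (#) as' bs'))" using ab as bs by simp
  then obtain ws where ws: "T = cyc (a # ws)" "der (a # ws) = a # der ws"
    "der ws = b @ concat (map2 (#) as' bs')" "a = Pos \<Longrightarrow> last (a # ws) = Pos"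
    using magnus_eq_Cons by metis
  have "\<exists>cs. valid_blocks (Suc m) (a # as') cs a \<and> a # ws = concat (map2 (#) (a # as') cs)"
    using ab(3) as bs ws by (intro valid_blocks_of_der) auto
  then obtain cs where "valid_blocks (Suc m) (a # as') cs a" "T = cyc (concat (map2 (#) (a # as') cs))"
    using ws(1) by auto
  then show ?thesis unfolding blow_up_iff ab(1) as by (metis list.sel(1))
qed

text \<open>The empty shape has to be excluded: its only blow-up is itself, whereas
  \<open>cyc [Pos, Neg]\<close> also has empty derivative.\<close>

theorem blow_up_iff_magnus:
  assumes "S \<noteq> cyc []"
  shows "blow_up m S T \<longleftrightarrow> (magnus ^^ m) T = S"
proof (induction m arbitrary: T)
  case 0
  then show ?case by (auto simp: blow_up_0)
next
  case (Suc m)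
  then show ?case using blow_up_magnus blow_up_of_magnus assms
    by (metis comp_apply funpow_Suc_right)
qed


section \<open>Clumps\<close>

text \<open>Only neighbours inside the word count; the ends are controlled separately through
  \<open>hd\<close> and \<open>last\<close>.\<close>

abbreviation no_double :: "letter \<Rightarrow> letter list \<Rightarrow> bool" where
  "no_double a \<equiv> successively (\<lambda>x y. \<not> (x = a \<and> y = a))"

text \<open>As \<open>1 < l\<close>, the first position of an arc has its successor in the arc, and
  every other one its predecessor.\<close>

lemma power_arc_neighbour:
  assumes "power_arc a xs C" "p \<in> C"
  shows "xs ! p = a \<and> p < length xs \<and>
    (xs ! (Suc p mod length xs) = a \<or> (\<exists>q<length xs. xs ! q = a \<and> p = Suc q mod length xs))"
proof -
  obtain i l where C: "i < length xs" "1 < l" "C = arc (length xs) i l" "\<forall>p\<in>C. xs ! p = a"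
    using assms(1) by (auto simp: power_arc_def)
  obtain j where j: "j < l" "p = (i + j) mod length xs" using assms(2) C by (auto simp: arc_def)
  have mem: "k < l \<Longrightarrow> (i + k) mod length xs \<in> C" for k using C by (auto simp: arc_def)
  have "xs ! (Suc p mod length xs) = a \<or> (\<exists>q<length xs. xs ! q = a \<and> p = Suc q mod length xs)"
  proof (cases j)
    case 0
    then have "(i + 1) mod length xs \<in> C" using C(2) by (intro mem)
    then show ?thesis using j 0 C by simp
  next
    case (Suc k)
    then have "(i + k) mod length xs \<in> C" using j by (intro mem) simp
    moreover have "p = Suc ((i + k) mod length xs) mod length xs"
      using j Suc by (simp add: mod_Suc_eq)
    moreover have "(i + k) mod length xs < length xs" using C(1) by (intro mod_less_divisor) linarith
    ultimately show ?thesis using C(4) by blast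
  qed
  then show ?thesis using assms C power_arc_subset by blast
qed

text \<open>A letter \<open>c\<close> in \<open>w\<close> has no equal neighbour: inside
  \<open>w\<close> by \<open>no_double\<close>, at the ends because the end letters differ from the
  adjacent \<open>a\<close>. Leaving \<open>c\<close> arbitrary covers both suitable and one-clump
  shapes.\<close>

lemma power_arc_replicate_append:
  assumes xs: "xs = replicate s a @ w" and "w \<noteq> []" "hd w \<noteq> a" "last w \<noteq> a" "no_double c w"
    "power_arc c xs C" "0 < s"
  shows "C \<subseteq> {..<s} \<and> c = a"
proof -
  have nd: "\<not> (w ! i = c \<and> w ! Suc i = c)" if "Suc i < length w" for i
    using assms that by (simp add: successively_conv_nth)
  have w0: "w ! 0 \<noteq> a" "w ! (length w - 1) \<noteq> a" using assms by (auto simp: hd_conv_nth last_conv_nth)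
  have sub: "p < s" if "p \<in> C" for p
  proof (rule ccontr)
    assume "\<not> p < s"
    then obtain i where i: "p = s + i" using le_Suc_ex not_less by blast
    have n: "length xs = s + length w" using xs by simp
    from power_arc_neighbour[OF assms(6) that]
    have *: "xs ! p = c" "p < length xs"
      "xs ! (Suc p mod length xs) = c \<or> (\<exists>q<length xs. xs ! q = c \<and> p = Suc q mod length xs)" by auto
    have i': "i < length w" "w ! i = c" using * i xs by (auto simp: nth_append)
    show False using *(3)
    proof (elim disjE exE conjE)
      assume s: "xs ! (Suc p mod length xs) = c"
      show False
      proof (cases "Suc i < length w")
        case True
        then have "Suc p mod length xs = s + Suc i" using n i by simp
        then show False using nd[OF True] i' s xs by (simp add: nth_append)
      next
        case False
        then have "Suc i = length w" using i' by simp
        then have "Suc p = length xs" "w ! i \<noteq> a" using n i w0(2) by (auto simp flip: \<open>Suc i = length w\<close>)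
        \<comment> \<open>The successor of the last letter of \<open>w\<close> wraps around to the
          start of the run.\<close>
        then have "Suc p mod length xs = 0" by simp
        moreover have "xs ! 0 = a" using xs \<open>0 < s\<close> by (simp add: nth_append)
        ultimately show False using i' s \<open>w ! i \<noteq> a\<close> by simp
      qed
    next
      fix q assume q: "q < length xs" "xs ! q = c" "p = Suc q mod length xs"
      \<comment> \<open>No wrap-around occurs here, since \<open>p\<close> is at least
        \<open>s\<close> and so positive.\<close>
      have "Suc q = p" using q i \<open>0 < s\<close> by (cases "Suc q = length xs") auto
      show False
      proof (cases i)
        case 0
        have "xs ! q = a" using \<open>Suc q = p\<close> i 0 xs by (simp add: nth_append)
        then show False using q(2) i'(2) 0 w0(1) by simp
      next
        case (Suc k)
        then have "w ! k = c" using \<open>Suc q = p\<close> q i xs by (auto simp: nth_append)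
        then show False using nd[of k] i' Suc by simp
      qed
    qed
  qed
  obtain p where "p \<in> C" using assms(6) by (auto simp: power_arc_def arc_def)
  then have "xs ! p = c" "p < s" using sub assms(6) by (auto simp: power_arc_def)
  then have "c = a" using xs by (simp add: nth_append)
  then show ?thesis using sub by auto
qed

lemma power_arc_replicate:
  assumes "xs = replicate s a @ w" "1 < s"
  shows "power_arc a xs {..<s}"
proof -
  have "arc (length xs) 0 s = id ` {..<s}"
    unfolding arc_def using assms(1) by (intro image_cong) auto
  then have "0 < length xs \<and> 1 < s \<and> s \<le> length xs \<and> {..<s} = arc (length xs) 0 s"
    using assms by simp
  moreover have "\<forall>p\<in>{..<s}. xs ! p = a" using assms(1) by (simp add: nth_append)
  ultimately show ?thesis unfolding power_arc_def by blast
qed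

lemma clump_replicate_append:
  assumes "xs = replicate s a @ w" "w \<noteq> []" "hd w \<noteq> a" "last w \<noteq> a" "no_double c w" "1 < s"
  shows "clump c xs C \<longleftrightarrow> c = a \<and> C = {..<s}"
proof -
  have sub: "power_arc c xs D \<Longrightarrow> D \<subseteq> {..<s} \<and> c = a" for D
    using assms by (intro power_arc_replicate_append) auto
  have "power_arc a xs {..<s}" using assms by (intro power_arc_replicate)
  then show ?thesis unfolding clump_def using sub by (metis subset_antisym)
qed

lemma suitable_replicate:
  assumes "w \<noteq> []" "hd w \<noteq> a" "last w \<noteq> a" "no_double a w" "1 < s"
  shows "suitable (cyc (replicate s a @ w))"
proof -
  have "{C. clump a (replicate s a @ w) C} = {{..<s}}"
    using clump_replicate_append[OF refl assms(1-4,5)] by auto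
  moreover have "{..<s} \<noteq> {..<length (replicate s a @ w)}" using assms(1) by auto
  ultimately show ?thesis unfolding suitable.abs_eq suitable_word_def by blast
qed

lemma one_clump_replicate:
  assumes "w \<noteq> []" "hd w \<noteq> a" "last w \<noteq> a" "\<And>c. no_double c w" "1 < s"
  shows "one_clump (cyc (replicate s a @ w))"
proof -
  have "{C. \<exists>c. clump c (replicate s a @ w) C} = {{..<s}}"
    using clump_replicate_append[OF refl assms(1-4,5)] by auto
  moreover have "{..<s} \<noteq> {..<length (replicate s a @ w)}" using assms(1) by auto
  ultimately show ?thesis unfolding one_clump.abs_eq one_clump_word_def by blast
qed

lemma one_clump_suitable: "one_clump S \<Longrightarrow> suitable S"
proof (transfer)
  fix xs assume "one_clump_word xs"
  then obtain C where C: "{C'. \<exists>a. clump a xs C'} = {C}" "C \<noteq> {..<length xs}"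
    by (auto simp: one_clump_word_def)
  then obtain a where "clump a xs C" by blast
  then have "{C'. clump a xs C'} = {C}" using C(1) by auto
  then show "suitable_word xs" using C(2) unfolding suitable_word_def by blast
qed

lemma not_suitable_Nil: "\<not> suitable (cyc [])"
proof -
  have "\<not> clump a [] C" for a C by (simp add: clump_def power_arc_def)
  then show ?thesis by (simp add: suitable.abs_eq suitable_word_def)
qed

lemma power_arc_extend:
  assumes "power_arc a xs C"
  obtains D where "clump a xs D" "C \<subseteq> D"
proof -
  have "finite {D. power_arc a xs D}"
    by (rule finite_subset[of _ "Pow {..<length xs}"]) (use power_arc_subset in auto)
  then obtain D where "C \<subseteq> D" "power_arc a xs D" "\<forall>E\<in>{D. power_arc a xs D}. D \<subseteq> E \<longrightarrow> E = D"
    using finite_has_maximal2[of "{D. power_arc a xs D}" C] assms by auto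
  then show thesis using that unfolding clump_def by blast
qed

text \<open>Rotate the unique clump of \<open>a\<close> to the front. Any two adjacent letters
  \<open>a\<close> lie in some clump of \<open>a\<close>, hence in this one, which yields the
  conditions on \<open>w\<close>.\<close>

lemma suitable_normal_form:
  assumes "suitable S"
  obtains a s w where "S = cyc (replicate s a @ w)" "w \<noteq> []" "hd w \<noteq> a" "last w \<noteq> a"
    "no_double a w" "1 < s"
proof -
  obtain xs where xs: "S = cyc xs" by (rule cshape_cases)
  then have "suitable_word xs" using assms by (simp add: suitable.abs_eq)
  then obtain a C where C: "{C'. clump a xs C'} = {C}" "C \<noteq> {..<length xs}"
    by (auto simp: suitable_word_def)
  let ?n = "length xs"
  have "power_arc a xs C" using C(1) by (auto simp: clump_def)
  then obtain i l where il: "i < ?n" "1 < l" "l \<le> ?n" "C = arc ?n i l" "\<forall>p\<in>C. xs ! p = a"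
    by (auto simp: power_arc_def)
  have inj: "j = k" if "(i + j) mod ?n = (i + k) mod ?n" "j < ?n" "k < ?n" for j k
    using that il(1)
    by (cases "i + j < ?n"; cases "i + k < ?n") (auto simp: le_mod_geq not_less)
  \<comment> \<open>An arc of full length covers all positions, which suitability excludes.\<close>
  have "l \<noteq> ?n"
  proof
    assume "l = ?n"
    have "inj_on (\<lambda>j. (i + j) mod ?n) {..<?n}" by (rule inj_onI, rule inj) auto
    then have "card C = ?n" unfolding il(4) arc_def \<open>l = ?n\<close> by (simp add: card_image)
    moreover have "C \<subseteq> {..<?n}" using il arc_subset by auto
    ultimately have "C = {..<?n}" by (intro card_subset_eq) auto
    then show False using C(2) by simp
  qed
  then have l: "l < ?n" using il by simp
  define ys where "ys = rotate i xs"
  have n: "length ys = ?n" by (simp add: ys_def)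
  have nth: "ys ! j = xs ! ((i + j) mod ?n)" if "j < ?n" for j
    using that by (simp add: ys_def nth_rotate)
  have less: "k mod ?n < ?n" for k using l by (intro mod_less_divisor) linarith
  \<comment> \<open>After the rotation the clump occupies the positions below \<open>l\<close>. Two
    neighbouring letters \<open>a\<close> form an arc of length 2, which extends to a clump.\<close>
  have pair: "j < l \<and> Suc j mod ?n < l"
    if "j < ?n" "ys ! j = a" "ys ! (Suc j mod ?n) = a" for j
  proof -
    have "power_arc a xs (arc ?n ((i + j) mod ?n) 2)"
    proof -
      have "xs ! ((i + j) mod ?n) = a" using nth that by simp
      moreover have "xs ! (Suc (i + j) mod ?n) = a"
        using nth[of "Suc j mod ?n"] that less by (simp add: mod_simps)
      moreover have "arc ?n ((i + j) mod ?n) 2 = {(i + j) mod ?n, Suc (i + j) mod ?n}"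
        by (auto simp: arc_def numeral_2_eq_2 lessThan_Suc mod_simps)
      moreover have "2 \<le> ?n" using il by simp
      ultimately show ?thesis unfolding power_arc_def using less
        by (intro conjI exI[of _ "(i + j) mod ?n"] exI[of _ 2]) auto
    qed
    then obtain D where "clump a xs D" "arc ?n ((i + j) mod ?n) 2 \<subseteq> D" by (rule power_arc_extend)
    then have sub: "arc ?n ((i + j) mod ?n) 2 \<subseteq> arc ?n i l" using C(1) il(4) by auto
    have mem: "k < l" if k: "(i + k) mod ?n \<in> arc ?n i l" "k < ?n" for k
    proof -
      obtain t where t: "(i + k) mod ?n = (i + t) mod ?n" "t < l" using k(1) by (auto simp: arc_def)
      then have "k = t" using inj[of k t] k(2) l by linarith
      then show ?thesis using t(2) by simp
    qed
    have "(i + j) mod ?n \<in> arc ?n i l" "(i + Suc j mod ?n) mod ?n \<in> arc ?n i l"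
      using sub by (auto simp: arc_def numeral_2_eq_2 lessThan_Suc mod_simps)
    then show ?thesis using mem that(1) less by blast
  qed
  define w where "w = drop l ys"
  have "take l ys = replicate l a"
  proof (rule nth_equalityI)
    fix j assume "j < length (take l ys)"
    then show "take l ys ! j = replicate l a ! j"
      using l n nth[of j] il(4,5) by (auto simp: arc_def)
  qed (use l n in auto)
  then have ys: "ys = replicate l a @ w" unfolding w_def by (metis append_take_drop_id)
  have w: "w \<noteq> []" using l n by (simp add: w_def)
  have ysw: "w ! j = ys ! (l + j)" if "j < length w" for j using that by (simp add: w_def)
  have lw: "length w = ?n - l" by (simp add: w_def n)
  show thesis
  proof
    show "S = cyc (replicate l a @ w)"
      using ys xs unfolding ys_def by (metis cshape.abs_eq_iff cyc_eq_def)
    show "hd w \<noteq> a"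
    proof
      assume "hd w = a"
      then have "ys ! l = a" using ysw[of 0] w by (simp add: hd_conv_nth)
      moreover have "ys ! (l - 1) = a" using ys il by (simp add: nth_append)
      moreover have "l - 1 < ?n" "Suc (l - 1) mod ?n = l" using il l by auto
      ultimately show False using pair[of "l - 1"] by simp
    qed
    show "last w \<noteq> a"
    proof
      assume "last w = a"
      then have "ys ! (?n - 1) = a" using ysw[of "length w - 1"] w lw l by (simp add: last_conv_nth)
      moreover have "ys ! 0 = a" using ys il by (simp add: nth_append)
      moreover have n1: "Suc (?n - 1) = ?n" "?n - 1 < ?n" "\<not> ?n - 1 < l" using l by linarith+
      moreover have "Suc (?n - 1) mod ?n = 0" unfolding n1(1) by simp
      ultimately show False using pair[of "?n - 1"] by metis
    qed
    show "no_double a w"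
      unfolding successively_conv_nth
    proof (intro allI impI notI, elim conjE)
      fix j assume j: "Suc j < length w" "w ! j = a" "w ! Suc j = a"
      then have "Suc (l + j) mod ?n = Suc (l + j)" "l + j < ?n" using lw by auto
      moreover have "ys ! (l + j) = a" "ys ! Suc (l + j) = a"
        using ysw[of j, symmetric] ysw[of "Suc j", symmetric] j by (simp_all only: add_Suc_right Suc_lessD)
      ultimately have "l + j < l" using pair[of "l + j"] by metis
      then show False by simp
    qed
  qed (use w il in auto)
qed


section \<open>Iterating the derivative\<close>

lemma magnus_lin_replicate_append:
  "w \<noteq> [] \<Longrightarrow> hd w \<noteq> a \<Longrightarrow>
    magnus_lin (replicate (Suc k) a @ w) e = replicate k a @ magnus_lin w e"
proof (induction k)
  case 0
  then show ?case by (cases w) auto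
qed auto

lemma magnus_cyc_replicate_append:
  assumes "w \<noteq> []" "hd w \<noteq> a" "0 < s"
  shows "magnus (cyc (replicate s a @ w)) = cyc (replicate (s - 1) a @ magnus_lin w a)"
proof -
  obtain k where "s = Suc k" using assms(3) gr0_conv_Suc by blast
  then show ?thesis using magnus_lin_replicate_append[OF assms(1,2), of k a]
    by (simp add: magnus.abs_eq magnus_word_lin)
qed

text \<open>The closing pair of \<open>last w\<close> with the following \<open>a\<close>
  contributes nothing either, as its letters differ.\<close>

lemma magnus_lin_no_double:
  "w \<noteq> [] \<Longrightarrow> last w \<noteq> a \<Longrightarrow> no_double a w \<Longrightarrow> a \<notin> set (magnus_lin w a)"
  by (induction w a rule: magnus_lin.induct) auto

lemma magnus_lin_Nil: "magnus_lin w e = [] \<Longrightarrow> no_double c w"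
  by (induction w e rule: magnus_lin.induct) (auto split: if_splits)

text \<open>Each derivative shortens both runs by one. Once a run has length 1, the other is the
  only clump or a single letter as well.\<close>

lemma two_runs_reach:
  assumes "a \<noteq> b" "0 < p" "0 < q"
  shows "\<exists>n. one_clump ((magnus ^^ n) (cyc (replicate p a @ replicate q b))) \<or>
    (magnus ^^ n) (cyc (replicate p a @ replicate q b)) = cyc [Pos, Neg]"
  using assms(2,3)
proof (induction p arbitrary: q)
  case (Suc p)
  let ?S = "cyc (replicate (Suc p) a @ replicate q b)"
  consider "q = 1" "p = 0" | "q = 1" "0 < p" | "1 < q" "p = 0" | "1 < q" "0 < p"
    using Suc.prems by linarith
  then show ?case
  proof cases
    case 1
    have "cyc [Neg, Pos] = cyc [Pos, Neg]" using cyc_append_commute[of "[Neg]" "[Pos]"] by simp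
    then have "?S = cyc [Pos, Neg]" using 1 assms(1) by (cases a; cases b) auto
    then show ?thesis by (intro exI[of _ 0]) simp
  next
    case 2
    then have "one_clump ?S" using assms(1) by (intro one_clump_replicate) auto
    then show ?thesis by (intro exI[of _ 0]) simp
  next
    case 3
    then have "one_clump (cyc (replicate q b @ [a]))"
      using assms(1) by (intro one_clump_replicate) auto
    moreover have "?S = cyc (replicate q b @ [a])"
      using 3 cyc_append_commute[of "[a]" "replicate q b"] by simp
    ultimately show ?thesis by (intro exI[of _ 0]) simp
  next
    case 4
    obtain k where k: "q = Suc k" "0 < k" using 4 by (cases q) auto
    have "magnus_lin (replicate (Suc k) b) a = replicate k b" for k
      using assms(1) by (induction k) auto
    then have "magnus ?S = cyc (replicate p a @ replicate k b)"
      using magnus_cyc_replicate_append[of "replicate q b" a "Suc p"] k assms(1) by auto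
    moreover obtain n where "one_clump ((magnus ^^ n) (cyc (replicate p a @ replicate k b))) \<or>
      (magnus ^^ n) (cyc (replicate p a @ replicate k b)) = cyc [Pos, Neg]"
      using Suc.IH[of k] 4 k by auto
    ultimately show ?thesis
      by (intro exI[of _ "Suc n"]) (simp add: funpow_Suc_right del: funpow.simps)
  qed
qed simp

lemma suitable_reach:
  assumes "suitable S"
  shows "\<exists>n. one_clump ((magnus ^^ n) S) \<or> (magnus ^^ n) S = cyc [Pos, Neg]"
proof -
  obtain a s w where S: "S = cyc (replicate s a @ w)" "w \<noteq> []" "hd w \<noteq> a" "last w \<noteq> a"
    "no_double a w" "1 < s"
    using suitable_normal_form[OF assms] .
  let ?v = "magnus_lin w a"
  show ?thesis
  \<comment> \<open>\<open>?v\<close> is what the part outside the clump contributes. If it is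
    empty, that part has no equal neighbours; otherwise it is a run of the other letter.\<close>
  proof (cases "?v = []")
    case True
    then have "one_clump S" using S magnus_lin_Nil by (auto intro!: one_clump_replicate)
    then show ?thesis by (intro exI[of _ 0]) simp
  next
    case False
    obtain b where b: "a \<noteq> b" using S(3) by metis
    have "a \<notin> set ?v" using S magnus_lin_no_double by blast
    then have "?v = replicate (length ?v) b"
      using letter_other[OF b] by (intro replicate_eqI) auto
    then have "magnus S = cyc (replicate (s - 1) a @ replicate (length ?v) b)"
      using magnus_cyc_replicate_append[OF S(2,3)] S by simp
    then obtain n where "one_clump ((magnus ^^ n) (magnus S)) \<or> (magnus ^^ n) (magnus S) = cyc [Pos, Neg]"
      using two_runs_reach[OF b, of "s - 1" "length ?v"] S(6) False by auto
    then show ?thesis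
      by (intro exI[of _ "Suc n"]) (simp add: funpow_Suc_right del: funpow.simps)
  qed
qed

section \<open>Shapes with derivative \<open>tt^-1\<close>\<close>

lemma der_Nil: "der xs = [] \<Longrightarrow> \<exists>k. xs = concat (replicate k [Neg, Pos])"
proof (induction xs rule: der.induct)
  case (5 xs)
  then obtain k where "xs = concat (replicate k [Neg, Pos])" by auto
  then show ?case by (intro exI[of _ "Suc k"]) simp
qed (auto intro: exI[of _ 0])

text \<open>Undoing the deletion, \<open>T\<close> reads
  \<open>Pos (Neg Pos)^j Neg (Neg Pos)^k\<close> with \<open>k > 0\<close>. Cyclically the final
  \<open>Pos\<close> meets the initial one, and they form the only up clump.\<close>

lemma suitable_of_magnus:
  assumes "magnus T = cyc [Pos, Neg]"
  shows "suitable T"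
proof -
  obtain ws where ws: "T = cyc (Pos # ws)" "der ws = [Neg]" "last (Pos # ws) = Pos"
    using magnus_eq_Cons[OF assms] by metis
  then obtain p q where pq: "ws = p @ Neg # q" "der p = []" "der q = []"
    using der_split[of ws "[]" Neg "[]"] by auto
  obtain j where j: "p = concat (replicate j [Neg, Pos])" using der_Nil pq by blast
  obtain k where k: "q = concat (replicate k [Neg, Pos])" using der_Nil pq by blast
  \<comment> \<open>With \<open>k = 0\<close> the word would end in the surviving
    \<open>Neg\<close>, against the choice of its starting point.\<close>
  have "k \<noteq> 0"
  proof
    assume "k = 0"
    then show False using ws(3) pq(1) k by simp
  qed
  then obtain k' where k': "k = Suc k'" by (cases k) auto
  let ?r = "\<lambda>k. concat (replicate k [Neg, Pos])"
  let ?w = "?r j @ Neg # ?r k' @ [Neg]"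
  have q: "q = ?r k' @ [Neg, Pos]" unfolding k k' by (induction k') auto
  have "T = cyc (replicate 2 Pos @ ?w)"
    using cyc_append_commute[of "Pos # ?r j @ Neg # ?r k' @ [Neg]" "[Pos]"] ws(1) pq(1) j q
    by (simp add: numeral_2_eq_2)
  moreover have hdr: "hd (?r i @ Neg # v) = Neg" for i v by (cases i) auto
  moreover have nd: "no_double Pos (?r i @ Neg # v)" if "no_double Pos (Neg # v)" for i v
  proof (induction i)
    case (Suc i)
    then show ?case using hdr[of i v] by (auto simp: successively_Cons)
  qed (use that in simp)
  moreover have "no_double Pos ?w"
    using nd[of "[]" k'] hdr[of k' "[]"] by (intro nd) (auto simp: successively_Cons)
  ultimately show ?thesis using suitable_replicate[of ?w Pos 2] by simp
qed

theorem theorem4p1: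
  fixes T :: cshape
  assumes "width T \<ge> 1"
  shows "amenable T \<longleftrightarrow>
    (\<exists>n. one_clump ((magnus ^^ n) T) \<or> (magnus ^^ n) T = cyc [Pos, Neg])"
proof
  assume "amenable T"
  then consider m S where "suitable S" "blow_up m S T" | "T = cyc [Pos, Neg]"
    unfolding amenable_def by blast
  then show "\<exists>n. one_clump ((magnus ^^ n) T) \<or> (magnus ^^ n) T = cyc [Pos, Neg]"
  proof cases
    case 1
    then have "(magnus ^^ m) T = S"
      using blow_up_iff_magnus[of S m T] not_suitable_Nil by auto
    then show ?thesis using suitable_reach[OF 1(1)] by (metis comp_apply funpow_add)
  next
    case 2
    then show ?thesis by (intro exI[of _ 0]) simp
  qed
next
  assume "\<exists>n. one_clump ((magnus ^^ n) T) \<or> (magnus ^^ n) T = cyc [Pos, Neg]"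
  then consider n where "suitable ((magnus ^^ n) T)" | "T = cyc [Pos, Neg]"
  proof (elim exE disjE)
    fix n assume "(magnus ^^ n) T = cyc [Pos, Neg]"
    \<comment> \<open>For \<open>n > 0\<close> the derivative just before the last is suitable; for
      \<open>n = 0\<close> the shape itself is \<open>cyc [Pos, Neg]\<close>, amenable by
      convention.\<close>
    then show ?thesis using that suitable_of_magnus by (cases n) auto
  qed (use that one_clump_suitable in blast)
  then show "amenable T"
  proof cases
    case 1
    then have "blow_up n ((magnus ^^ n) T) T" using blow_up_iff_magnus not_suitable_Nil by metis
    then show ?thesis using 1 unfolding amenable_def by blast
  qed (simp add: amenable_def)
qed

end
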